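(* $p_2 = 2$, and for every integer $n \geq 3$, $p_n \leq n-1$. That is, for $n\ge 3$ there exist $n-1$ lines in $\mathbb{R}^2$ such that every cell of $Q_n$ has an interior point lying on at least one of them, while for $n=2$ exactly two lines are needed.
   Context: For $n \geq 1$, $Q_n$ is the $n\times n$ chessboard in $[-1,1]^2$ whose cells are the closed squares $c_{ij} = \left[-1+(i-1)\frac 2n, -1+i\frac 2n\right] \times \left[-1+(j-1)\frac 2n, -1+j\frac 2n\right]$ for $i,j \in \{1,\dots,n\}$. A line $\ell$ pierces a cell $c_{ij}$ if $\ell \cap \operatorname{int} c_{ij} \neq \emptyset$. $p_n$ denotes the minimum number of lines needed to pierce every cell of $Q_n$. *)

theory Defs
  imports "HOL-Analysis.Analysis"
begin

definition cell :: "nat \<Rightarrow> nat \<Rightarrow> nat \<Rightarrow> (real \<times> real) set" where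
  "cell n i j =
     {-1 + (real i - 1) * (2 / real n) .. -1 + real i * (2 / real n)} \<times>
     {-1 + (real j - 1) * (2 / real n) .. -1 + real j * (2 / real n)}"

definition is_line :: "(real \<times> real) set \<Rightarrow> bool" where
  "is_line l \<longleftrightarrow> affine l \<and> aff_dim l = 1"

definition pierces :: "(real \<times> real) set \<Rightarrow> (real \<times> real) set \<Rightarrow> bool" where
  "pierces l c \<longleftrightarrow> l \<inter> interior c \<noteq> {}"

definition piercing_lines :: "nat \<Rightarrow> (real \<times> real) set set \<Rightarrow> bool" where
  "piercing_lines n L \<longleftrightarrow>
     finite L \<and> (\<forall>l\<in>L. is_line l) \<and>
     (\<forall>i\<in>{1..n}. \<forall>j\<in>{1..n}. \<exists>l\<in>L. pierces l (cell n i j))"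

(* The minimum is over a nonempty set: the n horizontal lines through the
   midpoints of the rows pierce every cell. *)
definition piercing_number :: "nat \<Rightarrow> nat" where
  "piercing_number n = (LEAST k. \<exists>L. piercing_lines n L \<and> card L = k)"

end

(* In units of cells, take for every a with 2 <= a <= n - 1 the line of slope slightly above 1
   through the centre of the antidiagonal cell (a, n + 1 - a). It pierces its whole diagonal,
   the cells of the next lower diagonal in columns at most a, and the cells of the next higher
   diagonal in columns at least a. Consecutive lines complement each other on the diagonal
   between them, so these n - 2 lines miss only the cells (1,n), (1,n-1), (n,2), (n,1).
   A single line through the centre of the board, of slope slightly above -1, pierces those. *)
theory Submission
  imports Defs
begin

section \<open>Lines in board coordinates\<close>

text \<open>\<open>a\<close> and \<open>b\<close> are in board units: origin at the lower left
  corner, cells of side 1, \<open>t\<close> standing for \<open>-1 + 2 * t / real n\<close>. Both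
  axes scale alike, so \<open>m\<close> is the true slope.\<close>

definition board_line :: "nat \<Rightarrow> real \<Rightarrow> real \<Rightarrow> real \<Rightarrow> (real \<times> real) set" where
  "board_line n m a b =
     {p. snd p - (-1 + 2 * b / real n) = m * (fst p - (-1 + 2 * a / real n))}"

lemma is_line_board_line: "is_line (board_line n m a b)"
proof -
  have eq: "board_line n m a b =
      {p. (- m, 1) \<bullet> p = (-1 + 2 * b / real n) - m * (-1 + 2 * a / real n)}"
    by (auto simp: board_line_def inner_prod_def algebra_simps)
  have nz: "(- m, 1) \<noteq> (0 :: real \<times> real)"
    by (simp add: zero_prod_def)
  show ?thesis
    unfolding is_line_def eq by (simp add: affine_hyperplane aff_dim_hyperplane[OF nz])
qed

lemma board_point_in_line_iff:
  assumes "n > 0"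
  shows "(-1 + 2 * x / real n, -1 + 2 * y / real n) \<in> board_line n m a b
    \<longleftrightarrow> y - b = m * (x - a)"
proof -
  have "(-1 + 2 * x / real n, -1 + 2 * y / real n) \<in> board_line n m a b
      \<longleftrightarrow> (2 / real n) * (y - b) = (2 / real n) * (m * (x - a))"
    by (simp add: board_line_def algebra_simps diff_divide_distrib)
  also have "\<dots> \<longleftrightarrow> y - b = m * (x - a)"
    using assms by (subst mult_cancel_left) auto
  finally show ?thesis .
qed

lemma pierces_cellI:
  assumes "n > 0" "real i - 1 < x" "x < real i" "real j - 1 < y" "y < real j"
    and "(-1 + 2 * x / real n, -1 + 2 * y / real n) \<in> l"
  shows "pierces l (cell n i j)"
proof -
  have "(-1 + 2 * x / real n, -1 + 2 * y / real n) \<in> interior (cell n i j)"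
    using assms(2-5)[THEN mult_strict_right_mono, of "2 / real n"] assms(1)
    by (simp add: cell_def interior_Times mult.commute)
  then show ?thesis
    using assms(6) by (auto simp: pierces_def)
qed

lemma pierces_board_line:
  assumes "n > 0" "real i - 1 < x" "x < real i"
    and "real j - 1 < b + m * (x - a)" "b + m * (x - a) < real j"
  shows "pierces (board_line n m a b) (cell n i j)"
  by (rule pierces_cellI[OF assms]) (subst board_point_in_line_iff[OF assms(1)], simp)

section \<open>The two kinds of lines, and the cells on steep lines\<close>

text \<open>Over at most \<open>n - 1\<close> columns the excess \<open>1 / (2 * real n)\<close>
  over slope 1 adds up to less than half a cell: it tilts the line past lattice points without
  pushing it off its diagonal.\<close>

definition steep_line :: "nat \<Rightarrow> nat \<Rightarrow> (real \<times> real) set" where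
  "steep_line n a =
     board_line n (1 + 1 / (2 * real n)) (real a - 1/2) (real n + 1/2 - real a)"

definition flat_line :: "nat \<Rightarrow> (real \<times> real) set" where
  "flat_line n = board_line n (- (1 - 1 / (2 * real n))) (real n / 2) (real n / 2)"

lemma steep_line_pierces:
  assumes n: "n > 0" and i: "1 \<le> i" "i \<le> n" and a: "1 \<le> a" "a \<le> n"
    and j: "i + n + 1 = j + 2 * a \<or> (i + n + 2 = j + 2 * a \<and> a \<le> i) \<or> (i + n = j + 2 * a \<and> i \<le> a)"
  shows "pierces (steep_line n a) (cell n i j)"
proof -
  define e where "e = 1 / (2 * real n)"
  \<comment> \<open>\<open>u\<close> is the vertical drift from the slope-1 line at the middle of
    column \<open>i\<close>.\<close>
  define u where "u = e * (real i - real a)"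
  have e: "0 < e" "e \<le> 1/2" "e * real n = 1/2"
    using n by (auto simp: e_def field_simps)
  have "e * (real i - real a) \<le> e * (real n - 1)" "e * (1 - real n) \<le> e * (real i - real a)"
    using e i a by (auto intro!: mult_left_mono)
  then have u: "u \<le> 1/2 - e" "e - 1/2 \<le> u"
    using e by (auto simp: u_def algebra_simps)
  have ee: "0 < e * e" "e * e \<le> e / 2"
    using e mult_left_mono[of e "1/2" e] by auto
  \<comment> \<open>\<open>s\<close> is the distance to the right edge of column
    \<open>i\<close>.\<close>
  have val: "(real n + 1/2 - real a) + (1 + e) * (real i - s - (real a - 1/2))
      = real i + real n + 1 - 2 * real a - s + u + e * (1/2 - s)" for s
    by (simp add: u_def field_simps)
  have *: "pierces (steep_line n a) (cell n i j)"
    if "0 < s" "s < 1" "real j - 1 < real i + real n + 1 - 2 * real a - s + u + e * (1/2 - s)"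
       "real i + real n + 1 - 2 * real a - s + u + e * (1/2 - s) < real j" for s
    unfolding steep_line_def e_def[symmetric]
    using that by (intro pierces_board_line[OF n, where x = "real i - s"]) (auto simp: val)
  consider "real i + real n + 1 = real j + 2 * real a"
    | "real i + real n + 2 = real j + 2 * real a" "a \<le> i"
    | "real i + real n = real j + 2 * real a" "i \<le> a"
    using j by linarith
  then show ?thesis
  proof cases
    case 1
    then show ?thesis
      using u e by (intro *[of "1/2"]) auto
  next
    case 2
    \<comment> \<open>At the right edge the line is at least \<open>e/2\<close> above height
      \<open>j - 1\<close>; going left by \<open>e/4\<close> loses only
      \<open>e/4 + e * e / 4\<close>.\<close>
    then have "0 \<le> u"
      using e by (simp add: u_def)
    then show ?thesis
      using 2 u e ee by (intro *[of "e/4"]) (auto simp: algebra_simps)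
  next
    case 3
    \<comment> \<open>Mirror image: at the left edge the line is at least \<open>e/2\<close> below
      height \<open>j\<close>, and going right by \<open>e/4\<close> gains less than that.\<close>
    then have "u \<le> 0"
      using e by (simp add: u_def mult_nonneg_nonpos)
    then show ?thesis
      using 3 u e ee by (intro *[of "1 - e/4"]) (auto simp: algebra_simps)
  qed
qed

section \<open>Cells on the flat line\<close>

lemma pierces_flat_line:
  assumes n: "n > 0" and x: "real i - 1 < x" "x < real i"
    and y: "real j - 1 < real n - x + x / (2 * real n) - 1/4"
      "real n - x + x / (2 * real n) - 1/4 < real j"
  shows "pierces (flat_line n) (cell n i j)"
proof -
  have "real n / 2 + - (1 - 1 / (2 * real n)) * (x - real n / 2)
      = real n - x + x / (2 * real n) - 1/4"
    using n by (simp add: field_simps)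
  then show ?thesis
    unfolding flat_line_def using n x y by (intro pierces_board_line[where x = x]) simp_all
qed

lemma flat_line_pierces_corners:
  assumes n: "n \<ge> 2"
  shows "pierces (flat_line n) (cell n 1 n)" "pierces (flat_line n) (cell n n 1)"
proof -
  show "pierces (flat_line n) (cell n 1 n)"
    using n by (intro pierces_flat_line[where x = "1/2"]) (auto simp: field_simps)
  show "pierces (flat_line n) (cell n n 1)"
    using n by (intro pierces_flat_line[where x = "real n - 1/2"]) (auto simp: field_simps)
qed

text \<open>With \<open>e = 1 / (2 * real n)\<close>, at the right edge of column 1 the line has
  height \<open>n - 1 - (1/4 - e)\<close>, below \<open>n - 1\<close> as soon as
  \<open>e < 1/4\<close>; for \<open>n = 2\<close> it would only meet the corner. Going left by
  \<open>e/4\<close> keeps it below, since \<open>5 * e / 4 < 1/4\<close> for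
  \<open>e \<le> 1/6\<close>. The last column follows the same way, by symmetry about the
  centre.\<close>

lemma flat_line_pierces_near_corners:
  assumes n: "n \<ge> 3"
  shows "pierces (flat_line n) (cell n 1 (n - 1))" "pierces (flat_line n) (cell n n 2)"
proof -
  define e where "e = 1 / (2 * real n)"
  have e: "0 < e" "e * real n = 1/2"
    using n by (auto simp: e_def field_simps)
  have "e * 3 \<le> e * real n"
    using e n by (intro mult_left_mono) auto
  then have e': "e \<le> 1/6"
    using e by simp
  have ee: "0 < e * e" "e * e \<le> e / 6"
    using e e' mult_left_mono[of e "1/6" e] by auto
  have div: "x / (2 * real n) = e * x" for x
    by (simp add: e_def)
  have v: "e * (1 - e/4) = e - e * e / 4" "e * (real n - 1 + e/4) = 1/2 - e + e * e / 4"
    using e by (simp_all add: algebra_simps)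
  show "pierces (flat_line n) (cell n 1 (n - 1))"
    by (rule pierces_flat_line[where x = "1 - e/4"]; (unfold div v)?)
      (use n e e' ee in \<open>auto simp: of_nat_diff\<close>)
  show "pierces (flat_line n) (cell n n 2)"
    by (rule pierces_flat_line[where x = "real n - 1 + e/4"]; (unfold div v)?)
      (use n e e' ee in auto)
qed

section \<open>Distinctness of the lines\<close>

text \<open>The defining centres lie on a line of slope -1, which a line of positive slope meets
  only once.\<close>

lemma inj_steep_line:
  assumes "n > 0"
  shows "inj (steep_line n)"
proof (rule injI)
  fix a a' assume eq: "steep_line n a = steep_line n a'"
  define e where "e = 1 / (2 * real n)"
  have "(-1 + 2 * (real a - 1/2) / real n, -1 + 2 * (real n + 1/2 - real a) / real n)
      \<in> steep_line n a'"
    unfolding eq[symmetric] unfolding steep_line_def board_point_in_line_iff[OF assms] by simp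
  then have "real a' - real a = (1 + e) * (real a - real a')"
    unfolding steep_line_def board_point_in_line_iff[OF assms] e_def by (simp add: algebra_simps)
  then have "(2 + e) * (real a - real a') = 0"
    by (simp add: algebra_simps)
  moreover have "2 + e > 0"
    by (simp add: e_def add_pos_nonneg)
  ultimately show "a = a'"
    by simp
qed

lemma flat_line_neq_steep_line:
  assumes "n > 0"
  shows "flat_line n \<noteq> steep_line n a"
proof
  assume eq: "flat_line n = steep_line n a"
  define e where "e = 1 / (2 * real n)"
  have on_steep: "y - (real n + 1/2 - real a) = (1 + e) * (x - (real a - 1/2))"
    if "y - real n / 2 = - (1 - e) * (x - real n / 2)" for x y
    using that eq
      board_point_in_line_iff[OF assms, of x y "- (1 - e)" "real n / 2" "real n / 2"]
      board_point_in_line_iff[OF assms, of x y "1 + e" "real a - 1/2" "real n + 1/2 - real a"]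
    unfolding flat_line_def steep_line_def e_def by simp
  have "(1 + e) * (real n / 2 + 1 - (real a - 1/2)) = (1 + e) * (real n / 2 - (real a - 1/2)) + (1 + e)"
    by (simp add: algebra_simps)
  \<comment> \<open>One unit right of the board's centre the flat line has dropped by
    \<open>1 - e\<close>, while the steep line would have risen by \<open>1 + e\<close>. The
    instantiation lists \<open>y\<close> before \<open>x\<close>.\<close>
  then show False
    using on_steep[of "real n / 2" "real n / 2"]
      on_steep[of "real n / 2 - (1 - e)" "real n / 2 + 1"] by simp
qed

section \<open>Piercing the board with \<open>n - 1\<close> lines\<close>

lemma ex_piercing_lines:
  assumes n: "n \<ge> 3"
  shows "\<exists>L. piercing_lines n L \<and> card L = n - 1"
proof -
  define L where "L = insert (flat_line n) (steep_line n ` {2..n - 1})"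
  have "flat_line n \<notin> steep_line n ` {2..n - 1}"
    using flat_line_neq_steep_line[of n] n by auto
  moreover have "card (steep_line n ` {2..n - 1}) = n - 2"
    using inj_steep_line[of n] n by (subst card_image) (auto intro: inj_on_subset)
  ultimately have card: "card L = n - 1"
    using n by (simp add: L_def)
  have flat: "flat_line n \<in> L"
    by (simp add: L_def)
  have "\<exists>l\<in>L. pierces l (cell n i j)" if ij: "i \<in> {1..n}" "j \<in> {1..n}" for i j
  proof -
    have steep: ?thesis
      if "2 \<le> a" "a \<le> n - 1"
        "i + n + 1 = j + 2 * a \<or> (i + n + 2 = j + 2 * a \<and> a \<le> i) \<or> (i + n = j + 2 * a \<and> i \<le> a)"
      for a
      using steep_line_pierces[of n i a j] that ij n by (auto simp: L_def)
    consider (corner) "i = 1 \<and> j = n \<or> i = n \<and> j = 1 \<or> i = 1 \<and> j = n - 1 \<or> i = n \<and> j = 2"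
      | (other) "\<not> (i = 1 \<and> j = n \<or> i = n \<and> j = 1 \<or> i = 1 \<and> j = n - 1 \<or> i = n \<and> j = 2)"
      by blast
    then show ?thesis
    proof cases
      case corner
      then show ?thesis
        using flat flat_line_pierces_corners[of n] flat_line_pierces_near_corners[of n] n by auto
    next
      case other
      show ?thesis
      \<comment> \<open>Parity decides whether the cell's diagonal passes through some antidiagonal
        cell \<open>(a, n + 1 - a)\<close>. The values \<open>a = 1\<close> and
        \<open>a = n\<close>, which have no line, give only the corners. No subtraction truncates,
        as \<open>j \<le> n\<close>.\<close>
      proof (cases "even (i + n + 1 - j)")
        case True
        then obtain a where "i + n + 1 - j = 2 * a"
          by (elim evenE)
        then have a: "i + n + 1 = j + 2 * a"
          using ij by auto
        have "2 \<le> a"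
        proof (rule ccontr)
          assume "\<not> 2 \<le> a"
          then have "i = 1 \<and> j = n"
            using a ij by auto
          then show False
            using other by blast
        qed
        moreover have "a \<le> n - 1"
        proof (rule ccontr)
          assume "\<not> a \<le> n - 1"
          then have "i = n \<and> j = 1"
            using a ij by auto
          then show False
            using other by blast
        qed
        ultimately show ?thesis
          using a by (intro steep[of a]) auto
      next
        case False
        then have "even (i + n - j)"
          using ij by (auto simp: Suc_diff_le)
        then obtain a where "i + n - j = 2 * a"
          by (elim evenE)
        then have a: "i + n = j + 2 * a"
          using ij by auto
        \<comment> \<open>The cell is on the diagonal between those of lines \<open>a\<close> and
          \<open>a + 1\<close>: the former serves columns up to \<open>a\<close>, the latter the
          rest. The line required is absent only for \<open>(1, n - 1)\<close> and
          \<open>(n, 2)\<close>.\<close>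
        show ?thesis
        proof (cases "i \<le> a")
          case True
          have "2 \<le> a"
          proof (rule ccontr)
            assume "\<not> 2 \<le> a"
            then have "i = 1 \<and> j = n - 1"
              using a ij True by auto
            then show False
              using other by blast
          qed
          moreover have "a \<le> n - 1"
            using a ij by auto
          ultimately show ?thesis
            using a True by (intro steep[of a]) auto
        next
          case False
          have "a + 1 \<le> n - 1"
          proof (rule ccontr)
            assume "\<not> a + 1 \<le> n - 1"
            then have "i = n \<and> j = 2"
              using a ij False by auto
            then show False
              using other by blast
          qed
          moreover have "1 \<le> a"
            using a ij by auto
          ultimately show ?thesis
            using a False by (intro steep[of "a + 1"]) auto
        qed
      qed
    qed
  qed
  then have "piercing_lines n L"
    by (auto simp: piercing_lines_def L_def flat_line_def steep_line_def is_line_board_line)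
  with card show ?thesis
    by blast
qed

section \<open>The two by two board\<close>

lemma ex_piercing_lines_2: "\<exists>L. piercing_lines 2 L \<and> card L = 2"
proof -
  define d where "d = board_line 2 1 1 1"
  define L where "L = {flat_line 2, d}"
  have "pierces d (cell 2 1 1)" "pierces d (cell 2 2 2)"
    unfolding d_def
    by (rule pierces_board_line[where x = "1/2"]; simp)
       (rule pierces_board_line[where x = "3/2"]; simp)
  moreover have "pierces (flat_line 2) (cell 2 1 2)" "pierces (flat_line 2) (cell 2 2 1)"
    using flat_line_pierces_corners[of 2] by simp_all
  moreover have "{1..2} = {1, 2 :: nat}"
    by auto
  ultimately have "piercing_lines 2 L"
    by (auto simp: piercing_lines_def L_def d_def flat_line_def is_line_board_line)
  \<comment> \<open>Here \<open>(1, 1)\<close> is in true coordinates, the upper right corner of the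
    board; \<open>d\<close> is the line y = x.\<close>
  moreover have "(1, 1) \<in> d" "(1, 1) \<notin> flat_line 2"
    by (auto simp: d_def flat_line_def board_line_def)
  then have "card L = 2"
    by (auto simp: L_def card_insert_if)
  ultimately show ?thesis
    by blast
qed

text \<open>The open cells lie in the four open quadrants. A nonzero linear form strictly increases
  from one quadrant to the opposite one, for the pair picked by its coefficient signs, so no level
  set meets both.\<close>

lemma line_misses_cell_2:
  assumes "is_line l"
  shows "\<exists>i\<in>{1..2}. \<exists>j\<in>{1..2}. \<not> pierces l (cell 2 i j)"
proof (rule ccontr)
  assume "\<not> ?thesis"
  then have p: "pierces l (cell 2 1 1)" "pierces l (cell 2 1 2)"
      "pierces l (cell 2 2 1)" "pierces l (cell 2 2 2)"
    by auto
  have dim: "aff_dim l = int (DIM(real \<times> real) - 1)" and hull: "affine hull l = l"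
    using assms by (auto simp: is_line_def hull_same)
  \<comment> \<open>In the plane a line has codimension 1, so it is a hyperplane.\<close>
  obtain v c where v: "v \<noteq> 0" "l = {p. v \<bullet> p = c}"
    using iffD1[OF aff_dim_eq_hyperplane dim] unfolding hull by blast
  obtain a b where ab: "v = (a, b)"
    by (cases v)
  have l: "a * x + b * y = c" if "(x, y) \<in> l" for x y
    using that by (simp add: v ab)
  have nz: "a \<noteq> 0 \<or> b \<noteq> 0"
    using v ab by (auto simp: zero_prod_def)
  obtain x1 y1 where q1: "x1 < 0" "y1 < 0" "a * x1 + b * y1 = c"
    using p(1) l by (fastforce simp: pierces_def cell_def interior_Times)
  obtain x2 y2 where q2: "x2 < 0" "y2 > 0" "a * x2 + b * y2 = c"
    using p(2) l by (fastforce simp: pierces_def cell_def interior_Times)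
  obtain x3 y3 where q3: "x3 > 0" "y3 < 0" "a * x3 + b * y3 = c"
    using p(3) l by (fastforce simp: pierces_def cell_def interior_Times)
  obtain x4 y4 where q4: "x4 > 0" "y4 > 0" "a * x4 + b * y4 = c"
    using p(4) l by (fastforce simp: pierces_def cell_def interior_Times)
  have less: "t * x < t * x'" if "t > 0 \<and> x < x' \<or> t < 0 \<and> x > x'" for t x x' :: real
    using that mult_strict_left_mono mult_strict_left_mono_neg by blast
  have mono: "a * x + b * y < a * x' + b * y'"
    if "a > 0 \<and> x < x' \<or> a < 0 \<and> x > x' \<or> a = 0" "b > 0 \<and> y < y' \<or> b < 0 \<and> y > y' \<or> b = 0"
    for x y x' y'
  proof -
    have "a * x < a * x' \<or> a = 0" "b * y < b * y' \<or> b = 0"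
      using that less by blast+
    then show ?thesis
      using nz by auto
  qed
  consider "a \<ge> 0" "b \<ge> 0" | "a \<le> 0" "b \<le> 0" | "a \<ge> 0" "b \<le> 0" | "a \<le> 0" "b \<ge> 0"
    by linarith
  then show False
  proof cases
    case 1
    then show ?thesis
      using mono[of x1 x4 y1 y4] q1 q4 by linarith
  next
    case 2
    then show ?thesis
      using mono[of x4 x1 y4 y1] q1 q4 by linarith
  next
    case 3
    then show ?thesis
      using mono[of x2 x3 y2 y3] q2 q3 by linarith
  next
    case 4
    then show ?thesis
      using mono[of x3 x2 y3 y2] q2 q3 by linarith
  qed
qed

lemma card_piercing_lines_2:
  assumes "piercing_lines 2 L"
  shows "2 \<le> card L"
proof (rule ccontr)
  assume "\<not> ?thesis"
  then have "card L = 0 \<or> card L = 1"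
    by auto
  \<comment> \<open>An infinite \<open>L\<close> would also have \<open>card L = 0\<close>;
    finiteness in \<open>piercing_lines\<close> excludes it.\<close>
  then consider "L = {}" | l where "L = {l}"
    using assms by (auto simp: piercing_lines_def card_1_singleton_iff)
  then show False
  proof cases
    case 1
    with assms show ?thesis
      by (auto simp: piercing_lines_def)
  next
    case 2
    with assms line_misses_cell_2[of l] show ?thesis
      by (fastforce simp: piercing_lines_def)
  qed
qed

theorem theorem2:
  shows "piercing_number 2 = 2 \<and>
    (\<forall>n\<ge>3. piercing_number n \<le> n - 1 \<and>
            (\<exists>L. piercing_lines n L \<and> card L = n - 1))"
proof (intro conjI allI impI)
  show "piercing_number 2 = 2"
    unfolding piercing_number_def
    using ex_piercing_lines_2 card_piercing_lines_2 by (blast intro: Least_equality)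
  fix n :: nat assume "3 \<le> n"
  then show *: "\<exists>L. piercing_lines n L \<and> card L = n - 1"
    by (rule ex_piercing_lines)
  show "piercing_number n \<le> n - 1"
    unfolding piercing_number_def by (rule Least_le) (rule *)
qed

end
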